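(* The optimal values of the selection and relay variables $\{(\delta_{lk},\pi_{lk}) : l\in\overline{\mathcal{N}}_{k\leftarrow},\ k\in\mathcal{N}\}$ in problem (P2) are invariant to a homogeneous scaling of the $\gamma_l$, $l\in\mathcal{N}$. That is, for every constant $\alpha>0$, a family $\{(\delta_{lk},\pi_{lk})\}$ is the $(\delta,\pi)$-part of an optimal solution of (P2) with data $(\gamma_l)_{l\in\mathcal{N}}$ if and only if it is the $(\delta,\pi)$-part of an optimal solution of (P2) with data $(\alpha\gamma_l)_{l\in\mathcal{N}}$ (all other problem data being unchanged, and the bounds $\underline{z}_k,\bar z_k$ being recomputed from the scaled data).
   Context: Let $\mathcal{G}=(\mathcal{N},\mathcal{E})$ be a directed graph on $\mathcal{N}=\{1,\dots,N\}$ with the simple-topology property: for any ordered pair of distinct nodes there is at most one directed simple path from the first to the second. $\overline{\mathcal{N}}_{k\leftarrow}$ (multi-hop neighborhood) is the set consisting of $k$ and all nodes $l$ from which there is a directed path to $k$. $\overline{\mathcal{N}}_{l\rightarrow}$ (reachable neighborhood) is the set of all nodes $j\ne l$ to which there is a directed path from $l$. The binary constant $\eta_{lj,k}$ equals $1$ if node $k$ is on the unique directed path from $l$ to $j$ (with $l$ itself being on the path), and $0$ otherwise. Data: positive reals $\gamma_l$ ($l\in\mathcal{N}$; $\gamma_l^2$ is the composite variance of node $l$), cost per broadcast $c_k^{cm,0}>0$, node budgets $c_k\ge0$, network budget $c\ge0$, and $\underline z_k=\big(\sum_{l\in\overline{\mathcal{N}}_{k\leftarrow}}\gamma_l^{-2}\big)^{-1}$,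 $\bar z_k=\big(\min_{l\in\overline{\mathcal{N}}_{k\leftarrow}}\gamma_l^{-2}\big)^{-1}$. Problem (P2) is the mixed integer linear program: minimize $\sum_{k\in\mathcal{N}}z_k$ over $\delta_{lk}\in\{0,1\}$, $\pi_{lk}\in\{0,1\}$, $p_{lk}\ge0$ (for all $l\in\overline{\mathcal{N}}_{k\leftarrow}$, $k\in\mathcal{N}$) and $z_k\ge0$ ($k\in\mathcal{N}$), subject to (1) $\sum_{l\in\overline{\mathcal{N}}_{k\leftarrow}}\gamma_l^{-2}p_{lk}=1$ for all $k$; (2) $\underline z_k\delta_{lk}\le p_{lk}\le\bar z_k\delta_{lk}$ for all $l\in\overline{\mathcal{N}}_{k\leftarrow}$, $k\in\mathcal{N}$; (3) $z_k+\bar z_k(\delta_{lk}-1)\le p_{lk}\le z_k+\underline z_k(\delta_{lk}-1)$ for all $l\in\overline{\mathcal{N}}_{k\leftarrow}$, $k\in\mathcal{N}$; (4) $\pi_{lk}\le\sum_{j\in\overline{\mathcal{N}}_{l\rightarrow}\setminus\{k\}}\eta_{lj,k}\delta_{lj}\le|\overline{\mathcal{N}}_{l\rightarrow}|\,\pi_{lk}$ for all $l\in\overline{\mathcal{N}}_{k\leftarrow}$, $k\in\mathcal{N}$; (5) $\sum_{l\in\overline{\mathcal{N}}_{k\leftarrow}}c_k^{cm,0}\pi_{lk}\le c_k$ for all $k\in\mathcal{N}$; (6) $\sum_{k\in\mathcal{N}}\sum_{l\in\overline{\mathcal{N}}_{k\leftarrow}}c_k^{cm,0}\pi_{lk}\le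 c$. Here $\delta_{lk}=1$ means node $l$ is selected as an information neighbor of node $k$, and $\pi_{lk}=1$ means node $k$ relays (broadcasts) information originating from node $l$. *)

theory Defs
  imports Complex_Main "Graph_Theory.Pair_Digraph"
begin

text \<open>
  Simple directed paths are the arc paths \<open>apath\<close>. In a pair digraph an arc is the pair of
  its end points, so uniqueness of the arc list is uniqueness of the path.
\<close>

definition simple_topology :: "'a pair_pre_digraph \<Rightarrow> bool" where
  "simple_topology G \<longleftrightarrow>
     (\<forall>u\<in>pverts G. \<forall>v\<in>pverts G. u \<noteq> v \<longrightarrow> (\<exists>\<^sub>\<le>\<^sub>1 p. pre_digraph.apath (with_proj G) u p v))"

text \<open>\<open>reachable\<close> is reflexive on vertices, so \<open>k\<close> belongs to its own multi-hop neighborhood.\<close>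

definition multihop_nbhd :: "'a pair_pre_digraph \<Rightarrow> 'a \<Rightarrow> 'a set" where
  "multihop_nbhd G k = {l \<in> pverts G. l \<rightarrow>\<^sup>*\<^bsub>with_proj G\<^esub> k}"

definition reachable_nbhd :: "'a pair_pre_digraph \<Rightarrow> 'a \<Rightarrow> 'a set" where
  "reachable_nbhd G l = {j \<in> pverts G. j \<noteq> l \<and> l \<rightarrow>\<^sup>*\<^bsub>with_proj G\<^esub> j}"

text \<open>
  Under \<open>simple_topology\<close> the path \<open>p\<close> below is unique for \<open>l \<noteq> j\<close>. Its vertex list
  \<open>awalk_verts\<close> includes both end points \<open>l\<close> and \<open>j\<close>.
\<close>

definition on_path :: "'a pair_pre_digraph \<Rightarrow> 'a \<Rightarrow> 'a \<Rightarrow> 'a \<Rightarrow> real" where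
  "on_path G l j k =
     (if \<exists>p. pre_digraph.apath (with_proj G) l p j \<and>
             k \<in> set (pre_digraph.awalk_verts (with_proj G) l p)
      then 1 else 0)"

definition z_lower :: "'a pair_pre_digraph \<Rightarrow> ('a \<Rightarrow> real) \<Rightarrow> 'a \<Rightarrow> real" where
  "z_lower G \<gamma> k = 1 / (\<Sum>l\<in>multihop_nbhd G k. 1 / (\<gamma> l)\<^sup>2)"

definition z_upper :: "'a pair_pre_digraph \<Rightarrow> ('a \<Rightarrow> real) \<Rightarrow> 'a \<Rightarrow> real" where
  "z_upper G \<gamma> k = 1 / (MIN l\<in>multihop_nbhd G k. 1 / (\<gamma> l)\<^sup>2)"

text \<open>
  The mixed integer linear program P2. The data are the graph \<open>G\<close>, the \<open>\<gamma>\<close>, the cost per broadcast \<open>c_bc\<close>, the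
  node budgets \<open>c_node\<close> and the network budget \<open>c_net\<close>. The decision variables
  \<open>\<delta>\<close>, \<open>\<pi>\<close>, \<open>p\<close> are indexed by the pairs \<open>(l, k)\<close> with \<open>k\<close> a node and
  \<open>l \<in> multihop_nbhd G k\<close>, and \<open>z\<close> by the nodes. They are represented by total functions whose
  values at other indices are neither constrained nor used: in the relay constraint,
  \<open>j \<in> reachable_nbhd G l\<close> implies \<open>l \<in> multihop_nbhd G j\<close>.
\<close>

definition P2_feasible ::
  "'a pair_pre_digraph \<Rightarrow> ('a \<Rightarrow> real) \<Rightarrow> ('a \<Rightarrow> real) \<Rightarrow> ('a \<Rightarrow> real) \<Rightarrow> real \<Rightarrow>
   ('a \<Rightarrow> 'a \<Rightarrow> real) \<Rightarrow> ('a \<Rightarrow> 'a \<Rightarrow> real) \<Rightarrow> ('a \<Rightarrow> 'a \<Rightarrow> real) \<Rightarrow> ('a \<Rightarrow> real) \<Rightarrow> bool" where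
  "P2_feasible G \<gamma> c_bc c_node c_net \<delta> \<pi> p z \<longleftrightarrow>
     (\<forall>k\<in>pverts G. \<forall>l\<in>multihop_nbhd G k. \<delta> l k \<in> {0, 1} \<and> \<pi> l k \<in> {0, 1} \<and> 0 \<le> p l k) \<and>
     (\<forall>k\<in>pverts G. 0 \<le> z k) \<and>
     (\<forall>k\<in>pverts G. (\<Sum>l\<in>multihop_nbhd G k. 1 / (\<gamma> l)\<^sup>2 * p l k) = 1) \<and>
     (\<forall>k\<in>pverts G. \<forall>l\<in>multihop_nbhd G k.
        z_lower G \<gamma> k * \<delta> l k \<le> p l k \<and> p l k \<le> z_upper G \<gamma> k * \<delta> l k) \<and>
     (\<forall>k\<in>pverts G. \<forall>l\<in>multihop_nbhd G k.
        z k + z_upper G \<gamma> k * (\<delta> l k - 1) \<le> p l k \<and>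
        p l k \<le> z k + z_lower G \<gamma> k * (\<delta> l k - 1)) \<and>
     (\<forall>k\<in>pverts G. \<forall>l\<in>multihop_nbhd G k.
        \<pi> l k \<le> (\<Sum>j\<in>reachable_nbhd G l - {k}. on_path G l j k * \<delta> l j) \<and>
        (\<Sum>j\<in>reachable_nbhd G l - {k}. on_path G l j k * \<delta> l j)
          \<le> real (card (reachable_nbhd G l)) * \<pi> l k) \<and>
     (\<forall>k\<in>pverts G. (\<Sum>l\<in>multihop_nbhd G k. c_bc k * \<pi> l k) \<le> c_node k) \<and>
     (\<Sum>k\<in>pverts G. \<Sum>l\<in>multihop_nbhd G k. c_bc k * \<pi> l k) \<le> c_net"

definition P2_optimal ::
  "'a pair_pre_digraph \<Rightarrow> ('a \<Rightarrow> real) \<Rightarrow> ('a \<Rightarrow> real) \<Rightarrow> ('a \<Rightarrow> real) \<Rightarrow> real \<Rightarrow>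
   ('a \<Rightarrow> 'a \<Rightarrow> real) \<Rightarrow> ('a \<Rightarrow> 'a \<Rightarrow> real) \<Rightarrow> ('a \<Rightarrow> 'a \<Rightarrow> real) \<Rightarrow> ('a \<Rightarrow> real) \<Rightarrow> bool" where
  "P2_optimal G \<gamma> c_bc c_node c_net \<delta> \<pi> p z \<longleftrightarrow>
     is_arg_min (\<lambda>(\<delta>, \<pi>, p, z). \<Sum>k\<in>pverts G. z k)
       (\<lambda>(\<delta>, \<pi>, p, z). P2_feasible G \<gamma> c_bc c_node c_net \<delta> \<pi> p z) (\<delta>, \<pi>, p, z)"

end

(* Replacing \<gamma> by \<alpha> * \<gamma> multiplies both bounds on z by \<alpha>\<^sup>2, so
   (\<delta>, \<pi>, p, z) \<mapsto> (\<delta>, \<pi>, \<alpha>\<^sup>2 p, \<alpha>\<^sup>2 z) maps the feasible set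
   for \<gamma> into the one for \<alpha> * \<gamma> and multiplies the objective by \<alpha>\<^sup>2. Scaling by
   1 / \<alpha> gives the inverse map, so optimal solutions correspond. *)
theory Submission
  imports Defs
begin

text \<open>Reachability is reflexive on vertices. This keeps the set under the minimum in
  \<open>z_upper\<close> nonempty.\<close>

lemma self_in_multihop_nbhd:
  assumes "k \<in> pverts G"
  shows "k \<in> multihop_nbhd G k"
  using assms by (simp add: multihop_nbhd_def reachable_def rtrancl_on_refl)

lemma finite_multihop_nbhd:
  assumes "finite (pverts G)"
  shows "finite (multihop_nbhd G k)"
  using assms by (simp add: multihop_nbhd_def)

text \<open>A common factor leaves the sum. The case \<alpha> = 0 is covered by the convention 1 / 0
  = 0, which makes both sides vanish.\<close>

lemma z_lower_scale: "z_lower G (\<lambda>l. \<alpha> * \<gamma> l) k = \<alpha>\<^sup>2 * z_lower G \<gamma> k"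
proof -
  have "(\<Sum>l\<in>multihop_nbhd G k. 1 / (\<alpha> * \<gamma> l)\<^sup>2)
      = (1 / \<alpha>\<^sup>2) * (\<Sum>l\<in>multihop_nbhd G k. 1 / (\<gamma> l)\<^sup>2)"
    by (simp add: sum_distrib_left power_mult_distrib)
  then show ?thesis by (simp add: z_lower_def)
qed

text \<open>Multiplication by the nonnegative constant \<open>1 / \<alpha>\<^sup>2\<close> is
  monotone, so it commutes with the minimum of a finite nonempty set.\<close>

lemma z_upper_scale:
  assumes "finite (pverts G)" "k \<in> pverts G" "0 < \<alpha>"
  shows "z_upper G (\<lambda>l. \<alpha> * \<gamma> l) k = \<alpha>\<^sup>2 * z_upper G \<gamma> k"
proof -
  let ?A = "(\<lambda>l. 1 / (\<gamma> l)\<^sup>2) ` multihop_nbhd G k"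
  have "mono (\<lambda>x. (1 / \<alpha>\<^sup>2) * x)"
    by (intro monoI mult_left_mono) auto
  moreover have "finite ?A" "?A \<noteq> {}"
    using self_in_multihop_nbhd[OF assms(2)] finite_multihop_nbhd[OF assms(1)] by auto
  ultimately have "(1 / \<alpha>\<^sup>2) * Min ?A = Min ((\<lambda>x. (1 / \<alpha>\<^sup>2) * x) ` ?A)"
    by (rule mono_Min_commute)
  also have "\<dots> = (MIN l\<in>multihop_nbhd G k. 1 / (\<alpha> * \<gamma> l)\<^sup>2)"
    by (simp add: image_image power_mult_distrib mult.commute)
  finally have "(MIN l\<in>multihop_nbhd G k. 1 / (\<alpha> * \<gamma> l)\<^sup>2) = (1 / \<alpha>\<^sup>2) * Min ?A" ..
  then show ?thesis by (simp add: z_upper_def)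
qed

text \<open>The constraints linking \<open>p\<close>, \<open>z\<close> and the bounds are
  homogeneous, so both sides gain \<open>\<alpha>\<^sup>2\<close>; in the normalization the factor
  cancels against the scaled weights. The relay and budget constraints involve neither \<gamma> nor
  \<open>p\<close> nor \<open>z\<close>.\<close>

lemma P2_feasible_scale:
  assumes "finite (pverts G)" "0 < \<alpha>"
    and feas: "P2_feasible G \<gamma> c_bc c_node c_net \<delta> \<pi> p z"
  shows "P2_feasible G (\<lambda>l. \<alpha> * \<gamma> l) c_bc c_node c_net \<delta> \<pi>
           (\<lambda>l k. \<alpha>\<^sup>2 * p l k) (\<lambda>k. \<alpha>\<^sup>2 * z k)"
proof -
  have le: "\<alpha>\<^sup>2 * a \<le> \<alpha>\<^sup>2 * b \<longleftrightarrow> a \<le> b" for a b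
    using \<open>0 < \<alpha>\<close> by simp
  have norm: "1 / (\<alpha> * \<gamma> l)\<^sup>2 * (\<alpha>\<^sup>2 * x) = 1 / (\<gamma> l)\<^sup>2 * x" for l x
    using \<open>0 < \<alpha>\<close> by (simp add: power_mult_distrib)
  have lin: "\<alpha>\<^sup>2 * a + \<alpha>\<^sup>2 * b = \<alpha>\<^sup>2 * (a + b)" "\<alpha>\<^sup>2 * a * b = \<alpha>\<^sup>2 * (a * b)" for a b
    by (simp_all add: algebra_simps)
  \<comment> \<open>The sign constraints have a bare 0 on the left, with no visible factor for
    \<open>le\<close> to cancel.\<close>
  have "0 \<le> \<alpha>\<^sup>2 * a \<longleftrightarrow> 0 \<le> a" for a
    using le[of 0 a] by simp
  then show ?thesis
    using feas unfolding P2_feasible_def norm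
    \<comment> \<open>\<open>ball_cong\<close> supplies \<open>k \<in> pverts G\<close> under the
      quantifier, as \<open>z_upper_scale\<close> demands.\<close>
    by (simp only: z_lower_scale z_upper_scale[OF assms(1) _ assms(2)] lin le simp_thms ball_triv
        cong: ball_cong)
qed

lemma P2_optimal_scale:
  assumes "finite (pverts G)" "0 < \<alpha>"
    and opt: "P2_optimal G \<gamma> c_bc c_node c_net \<delta> \<pi> p z"
  shows "P2_optimal G (\<lambda>l. \<alpha> * \<gamma> l) c_bc c_node c_net \<delta> \<pi>
           (\<lambda>l k. \<alpha>\<^sup>2 * p l k) (\<lambda>k. \<alpha>\<^sup>2 * z k)"
proof -
  have feas: "P2_feasible G \<gamma> c_bc c_node c_net \<delta> \<pi> p z"
    using opt unfolding P2_optimal_def is_arg_min_linorder by auto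
  have min: "(\<Sum>k\<in>pverts G. z k) \<le> (\<Sum>k\<in>pverts G. z' k)"
      if "P2_feasible G \<gamma> c_bc c_node c_net \<delta>' \<pi>' p' z'" for \<delta>' \<pi>' p' z'
    using opt that unfolding P2_optimal_def is_arg_min_linorder by auto
  have "(\<Sum>k\<in>pverts G. \<alpha>\<^sup>2 * z k) \<le> (\<Sum>k\<in>pverts G. z' k)"
    if feas': "P2_feasible G (\<lambda>l. \<alpha> * \<gamma> l) c_bc c_node c_net \<delta>' \<pi>' p' z'" for \<delta>' \<pi>' p' z'
  proof -
    \<comment> \<open>A competitor for the scaled data is pulled back to the original data, where
      \<open>min\<close> applies.\<close>
    have "P2_feasible G \<gamma> c_bc c_node c_net \<delta>' \<pi>'
            (\<lambda>l k. (1 / \<alpha>)\<^sup>2 * p' l k) (\<lambda>k. (1 / \<alpha>)\<^sup>2 * z' k)"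
      using P2_feasible_scale[OF assms(1) _ feas', of "1 / \<alpha>"] \<open>0 < \<alpha>\<close> by simp
    \<comment> \<open>Multiplying the inequality by \<open>\<alpha>\<^sup>2\<close> undoes the
      pull-back factor on the right.\<close>
    from min[OF this] show ?thesis
      using \<open>0 < \<alpha>\<close> by (simp add: sum_divide_distrib[symmetric]
          power_divide pos_le_divide_eq mult.commute[of "\<alpha>\<^sup>2"] flip: sum_distrib_right)
  qed
  then show ?thesis
    using P2_feasible_scale[OF assms(1,2) feas]
    unfolding P2_optimal_def is_arg_min_linorder by auto
qed

theorem lemma1:
  fixes N :: nat and G :: "nat pair_pre_digraph"
    and \<gamma> c_bc c_node :: "nat \<Rightarrow> real" and c_net \<alpha> :: real
    and \<delta> \<pi> :: "nat \<Rightarrow> nat \<Rightarrow> real"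
  assumes "pair_wf_digraph G" and "pverts G = {1..N}"
    and "simple_topology G"
    and "\<forall>l\<in>pverts G. 0 < \<gamma> l"
    and "\<forall>k\<in>pverts G. 0 < c_bc k"
    and "\<forall>k\<in>pverts G. 0 \<le> c_node k"
    and "0 \<le> c_net"
    and "0 < \<alpha>"
  shows "(\<exists>p z. P2_optimal G \<gamma> c_bc c_node c_net \<delta> \<pi> p z) \<longleftrightarrow>
         (\<exists>p z. P2_optimal G (\<lambda>l. \<alpha> * \<gamma> l) c_bc c_node c_net \<delta> \<pi> p z)"
proof
  have fin: "finite (pverts G)"
    using assms(2) by simp
  show "\<exists>p z. P2_optimal G (\<lambda>l. \<alpha> * \<gamma> l) c_bc c_node c_net \<delta> \<pi> p z"
    if "\<exists>p z. P2_optimal G \<gamma> c_bc c_node c_net \<delta> \<pi> p z"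
    using that P2_optimal_scale[OF fin \<open>0 < \<alpha>\<close>] by blast
  show "\<exists>p z. P2_optimal G \<gamma> c_bc c_node c_net \<delta> \<pi> p z"
    if "\<exists>p z. P2_optimal G (\<lambda>l. \<alpha> * \<gamma> l) c_bc c_node c_net \<delta> \<pi> p z"
  proof -
    from that obtain p z where "P2_optimal G (\<lambda>l. \<alpha> * \<gamma> l) c_bc c_node c_net \<delta> \<pi> p z"
      by blast
    \<comment> \<open>The scaled data are scaled once more:
      \<open>1 / \<alpha> * (\<alpha> * \<gamma> l)\<close> simplifies to
      \<open>\<gamma> l\<close>.\<close>
    from P2_optimal_scale[OF fin _ this, of "1 / \<alpha>"] \<open>0 < \<alpha>\<close> show ?thesis
      by auto
  qed
qed

end
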